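(* Let $k$ be a field, $n\ge2$, $R=k[x_1,\dots,x_n]$ and let $A=R/I$ be $d$-extremely narrow. Then $A$ has the Weak Lefschetz Property. More precisely, let $x\in R_1$ be such that there is a basis $F_1,\dots,F_a$ of $(I^{-1})_{-d}$ with $$\Big\{(\ell_1,\dots,\ell_a)\in R_1^a:\sum_{i=1}^a\ell_i\circ F_i=0\Big\}\subseteq x(R_0)^a .$$ If $\ell\in R_1$ is not a multiple of $x$, then the map $A_{i-1}\xrightarrow{\ell}A_i$ has maximal rank for all $i$.
   Context: $R$ is standard graded with maximal homogeneous ideal $\mathfrak m$; $I$ is a homogeneous ideal with $A=R/I$ artinian. $S=k[y_1,\dots,y_n]_{DP}$ is the divided power algebra with $\deg y_i=-1$; $R$ acts on $S$ by contraction ($x^{\mathbf d}\circ y^{(\mathbf e)}=y^{(\mathbf e-\mathbf d)}$ if $\mathbf e\ge\mathbf d$ componentwise, else $0$). $I^{-1}=\{g\in S:f\circ g=0\ \forall f\in I\}$. $s(A)$ is the top degree of $\operatorname{Soc}(A)=\operatorname{Ann}_A(\mathfrak m)$, and $t(I)$ is the smallest degree of a minimal generator of $I$. For $d\ge1$, $A$ is $d$-extremely narrow if $s(A)=t(I)=d$ and there exist a basis $F_1,\dots,F_a$ of $(I^{-1})_{-d}$ and $x\in R_1$ satisfying the displayed containment. $A$ has the Weak Lefschetz Property if there is a nonempty Zariski open subset of the projective space of linear forms such that for all $\ell$ in it multiplication $A_{i-1}\xrightarrow{\ell}A_i$ has maximal rank for all $i$. *)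

theory Defs
  imports "HOL-Library.Poly_Mapping" "HOL-Library.Cardinality" "HOL-Algebra.QuotRing" "HOL-Algebra.Embedded_Algebras"
begin

section \<open>The polynomial ring and its grading\<close>

text \<open>
  Exponent vectors are finitely supported functions from the index type of the variables to the
  naturals. The ring \<open>R\<close> is the monoid algebra of exponent vectors, whose multiplication
  is the one of \<^theory>\<open>HOL-Library.Poly_Mapping\<close>. The gradings are indexed by \<open>int\<close>,
  because the divided power algebra lives in non-positive degrees; negative components of \<open>R\<close>
  are zero.
\<close>

type_synonym ('n, 'k) mpoly = "('n \<Rightarrow>\<^sub>0 nat) \<Rightarrow>\<^sub>0 'k"

definition mpoly_ring :: "('n, 'k::field) mpoly ring" where
  "mpoly_ring = \<lparr>carrier = UNIV, monoid.mult = (*), one = 1, zero = 0, add = (+)\<rparr>"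

definition const :: "'k::field \<Rightarrow> ('n, 'k) mpoly" where
  "const c = Poly_Mapping.single 0 c"

definition mdeg :: "('n::finite \<Rightarrow>\<^sub>0 nat) \<Rightarrow> nat" where
  "mdeg m = (\<Sum>i\<in>UNIV. Poly_Mapping.lookup m i)"

definition forms :: "int \<Rightarrow> ('n::finite, 'k::field) mpoly set" where
  "forms i = {f. \<forall>m\<in>Poly_Mapping.keys f. int (mdeg m) = i}"

definition hom_component :: "int \<Rightarrow> ('n::finite, 'k::field) mpoly \<Rightarrow> ('n, 'k) mpoly" where
  "hom_component i f =
     (\<Sum>m | m \<in> Poly_Mapping.keys f \<and> int (mdeg m) = i.
        Poly_Mapping.single m (Poly_Mapping.lookup f m))"

definition homogeneous_ideal :: "('n::finite, 'k::field) mpoly set \<Rightarrow> bool" where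
  "homogeneous_ideal I \<longleftrightarrow>
     ideal I mpoly_ring \<and> (\<forall>f\<in>I. \<forall>i. hom_component i f \<in> I)"

definition irrelevant_ideal :: "('n, 'k::field) mpoly set" where
  "irrelevant_ideal = {f. Poly_Mapping.lookup f 0 = 0}"

definition minimal_homogeneous_generators ::
    "('n::finite, 'k::field) mpoly set \<Rightarrow> ('n, 'k) mpoly set \<Rightarrow> bool" where
  "minimal_homogeneous_generators I G \<longleftrightarrow>
     (\<forall>g\<in>G. \<exists>i. g \<in> forms i) \<and> genideal mpoly_ring G = I \<and>
     (\<forall>G'. G' \<subset> G \<longrightarrow> genideal mpoly_ring G' \<noteq> I)"

text \<open>
  \<open>t(I)\<close>. It is unspecified for \<open>I = 0\<close>, which has no minimal generators.
\<close>

definition initial_degree :: "('n::finite, 'k::field) mpoly set \<Rightarrow> nat" where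
  "initial_degree I =
     (LEAST t. \<exists>G. minimal_homogeneous_generators I G \<and> G \<inter> forms (int t) \<noteq> {})"


section \<open>The quotient algebra\<close>

definition artinian_ring :: "('a, 'b) ring_scheme \<Rightarrow> bool" where
  "artinian_ring A \<longleftrightarrow> ring A \<and>
     (\<forall>J :: nat \<Rightarrow> 'a set. (\<forall>i. ideal (J i) A) \<and> (\<forall>i. J (Suc i) \<subseteq> J i)
        \<longrightarrow> (\<exists>N. \<forall>i\<ge>N. J i = J N))"

abbreviation quotient_algebra :: "('n, 'k::field) mpoly set \<Rightarrow> ('n, 'k) mpoly set ring" where
  "quotient_algebra I \<equiv> mpoly_ring Quot I"

definition residue_class ::
    "('n, 'k::field) mpoly set \<Rightarrow> ('n, 'k) mpoly \<Rightarrow> ('n, 'k) mpoly set" where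
  "residue_class I f = I +>\<^bsub>mpoly_ring\<^esub> f"

definition quotient_component ::
    "('n::finite, 'k::field) mpoly set \<Rightarrow> int \<Rightarrow> ('n, 'k) mpoly set set" where
  "quotient_component I i = residue_class I ` forms i"

definition quotient_action ::
    "('n, 'k::field) mpoly set \<Rightarrow> ('n, 'k) mpoly \<Rightarrow> ('n, 'k) mpoly set \<Rightarrow> ('n, 'k) mpoly set" where
  "quotient_action I f u = residue_class I f \<otimes>\<^bsub>quotient_algebra I\<^esub> u"

definition socle :: "('n, 'k::field) mpoly set \<Rightarrow> ('n, 'k) mpoly set set" where
  "socle I = {u \<in> carrier (quotient_algebra I).
     \<forall>f\<in>irrelevant_ideal. quotient_action I f u = \<zero>\<^bsub>quotient_algebra I\<^esub>}"

text \<open>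
  \<open>s(A)\<close>. The degrees in question form a nonempty finite set when \<open>A\<close> is artinian and nonzero.
\<close>

definition socle_top_degree :: "('n::finite, 'k::field) mpoly set \<Rightarrow> nat" where
  "socle_top_degree I =
     (GREATEST s. \<exists>u \<in> socle I \<inter> quotient_component I (int s). u \<noteq> \<zero>\<^bsub>quotient_algebra I\<^esub>)"

text \<open>
  The dimension of a subspace of \<open>A\<close> over the image of the ground field, which is a subfield of
  \<open>A\<close> isomorphic to \<open>k\<close> as soon as \<open>A\<close> is nonzero.
\<close>

definition quotient_dim :: "('n, 'k::field) mpoly set \<Rightarrow> ('n, 'k) mpoly set set \<Rightarrow> nat" where
  "quotient_dim I V = ring.dim (quotient_algebra I) (range (\<lambda>c. residue_class I (const c))) V"

text \<open>
  The rank of multiplication by \<open>l\<close> from \<open>A\<^bsub>i-1\<^esub>\<close> to \<open>A\<^sub>i\<close>, i.e. the dimension of its image, is the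
  largest possible one.
\<close>

definition mult_maximal_rank ::
    "('n::finite, 'k::field) mpoly set \<Rightarrow> ('n, 'k) mpoly \<Rightarrow> int \<Rightarrow> bool" where
  "mult_maximal_rank I l i \<longleftrightarrow>
     quotient_dim I (quotient_action I l ` quotient_component I (i - 1)) =
     min (quotient_dim I (quotient_component I (i - 1))) (quotient_dim I (quotient_component I i))"


section \<open>The Weak Lefschetz Property\<close>

text \<open>
  The points of the projective space of linear forms are the lines in \<open>R\<^sub>1\<close>. A Zariski open set is
  the complement of the common zero locus of a set of homogeneous polynomials in the coefficients
  of the linear form. Open sets are sets of \<open>k\<close>-rational points.
\<close>

definition line :: "('n, 'k::field) mpoly \<Rightarrow> ('n, 'k) mpoly set" where
  "line l = range (\<lambda>c. const c * l)"

definition eval_mpoly :: "('n::finite, 'k::field) mpoly \<Rightarrow> ('n \<Rightarrow> 'k) \<Rightarrow> 'k" where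
  "eval_mpoly p a =
     (\<Sum>m\<in>Poly_Mapping.keys p. Poly_Mapping.lookup p m * (\<Prod>i\<in>UNIV. a i ^ Poly_Mapping.lookup m i))"

definition linear_coeffs :: "('n, 'k::field) mpoly \<Rightarrow> 'n \<Rightarrow> 'k" where
  "linear_coeffs l i = Poly_Mapping.lookup l (Poly_Mapping.single i 1)"

definition zariski_open_lines :: "('n::finite, 'k::field) mpoly set set \<Rightarrow> bool" where
  "zariski_open_lines U \<longleftrightarrow>
     (\<exists>T :: ('n, 'k) mpoly set. (\<forall>p\<in>T. \<exists>j. p \<in> forms j) \<and>
        U = {line l | l. l \<in> forms 1 \<and> l \<noteq> 0 \<and> (\<exists>p\<in>T. eval_mpoly p (linear_coeffs l) \<noteq> 0)})"

definition weak_lefschetz :: "('n::finite, 'k::field) mpoly set \<Rightarrow> bool" where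
  "weak_lefschetz I \<longleftrightarrow>
     (\<exists>U. zariski_open_lines U \<and> U \<noteq> {} \<and>
        (\<forall>l \<in> forms 1. l \<noteq> 0 \<and> line l \<in> U \<longrightarrow> (\<forall>i. mult_maximal_rank I l i)))"


section \<open>Divided powers, contraction and the inverse system\<close>

text \<open>
  An element of the divided power algebra \<open>S\<close> is a finitely supported family of coefficients of
  the divided monomials. Only the vector space structure of \<open>S\<close> and the contraction action are
  used: the multiplication of \<^theory>\<open>HOL-Library.Poly_Mapping\<close> is not the product of divided
  powers.
\<close>

type_synonym ('n, 'k) dpoly = "('n \<Rightarrow>\<^sub>0 nat) \<Rightarrow>\<^sub>0 'k"

definition dp_scale :: "'k::field \<Rightarrow> ('n, 'k) dpoly \<Rightarrow> ('n, 'k) dpoly" where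
  "dp_scale c F = Poly_Mapping.map ((*) c) F"

lemma lookup_dp_scale:
  "Poly_Mapping.lookup (dp_scale c F) m = c * Poly_Mapping.lookup F m"
  unfolding dp_scale_def by transfer (simp add: when_def)

interpretation dp: vector_space "dp_scale :: 'k::field \<Rightarrow> ('n, 'k) dpoly \<Rightarrow> ('n, 'k) dpoly"
  by unfold_locales
    (rule poly_mapping_eqI, simp add: lookup_dp_scale lookup_add algebra_simps)+

definition dp_component :: "int \<Rightarrow> ('n::finite, 'k::field) dpoly set" where
  "dp_component j = {F. \<forall>m\<in>Poly_Mapping.keys F. - int (mdeg m) = j}"

text \<open>
  Exponent vectors are compared componentwise; the library order on \<open>\<Rightarrow>\<^sub>0\<close> is lexicographic.
\<close>

definition contract :: "('n, 'k::field) mpoly \<Rightarrow> ('n, 'k) dpoly \<Rightarrow> ('n, 'k) dpoly" where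
  "contract f F =
     (\<Sum>m\<in>Poly_Mapping.keys f. \<Sum>e\<in>Poly_Mapping.keys F.
        if \<forall>i. Poly_Mapping.lookup m i \<le> Poly_Mapping.lookup e i
        then Poly_Mapping.single (e - m) (Poly_Mapping.lookup f m * Poly_Mapping.lookup F e)
        else 0)"

definition inverse_system :: "('n, 'k::field) mpoly set \<Rightarrow> ('n, 'k) dpoly set" where
  "inverse_system I = {g. \<forall>f\<in>I. contract f g = 0}"

definition dp_basis :: "('n, 'k::field) dpoly list \<Rightarrow> ('n, 'k) dpoly set \<Rightarrow> bool" where
  "dp_basis Fs V \<longleftrightarrow> distinct Fs \<and> dp.independent (set Fs) \<and> dp.span (set Fs) = V"


section \<open>Extremely narrow algebras\<close>

definition linear_syzygies ::
    "('n::finite, 'k::field) dpoly list \<Rightarrow> ('n, 'k) mpoly list set" where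
  "linear_syzygies Fs =
     {ls. length ls = length Fs \<and> set ls \<subseteq> forms 1 \<and>
          (\<Sum>i<length Fs. contract (ls ! i) (Fs ! i)) = 0}"

definition narrow_direction ::
    "nat \<Rightarrow> ('n::finite, 'k::field) mpoly set \<Rightarrow> ('n, 'k) mpoly \<Rightarrow> bool" where
  "narrow_direction d I x \<longleftrightarrow> x \<in> forms 1 \<and>
     (\<exists>Fs. dp_basis Fs (inverse_system I \<inter> dp_component (- int d)) \<and>
        linear_syzygies Fs \<subseteq>
          {map (\<lambda>c. x * c) cs | cs. length cs = length Fs \<and> set cs \<subseteq> forms 0})"

definition extremely_narrow :: "nat \<Rightarrow> ('n::finite, 'k::field) mpoly set \<Rightarrow> bool" where
  "extremely_narrow d I \<longleftrightarrow>
     1 \<le> d \<and> socle_top_degree I = d \<and> initial_degree I = d \<and> (\<exists>x. narrow_direction d I x)"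

end

theory Submission
  imports Defs
begin

text \<open>
  The hypotheses give \<open>I\<^sub>j = 0\<close> for \<open>j < d\<close> and \<open>A\<^sub>j = 0\<close> for \<open>j > d\<close>, so multiplication by \<open>l \<noteq> 0\<close> is
  injective into degrees below \<open>d\<close> and trivially surjective above \<open>d\<close>. In degree \<open>d\<close>, a proper image
  would be killed by a nonzero functional on \<open>R\<^sub>d\<close> vanishing on \<open>I\<^sub>d + l R\<^bsub>d-1\<^esub>\<close>, that is, by a nonzero
  \<open>F = \<Sum> c\<^sub>i F\<^sub>i\<close> in the inverse system with \<open>l \<circ> F = 0\<close>. Then \<open>(c\<^sub>1 l, \<dots>, c\<^sub>a l)\<close> is a linear syzygy,
  which forces \<open>l\<close> to be a multiple of \<open>x\<close>. The multiples of \<open>x\<close> are at most one point of the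
  projective space of linear forms, cut out by the two-by-two minors of the coefficients.
\<close>

section \<open>Polynomials and forms\<close>

abbreviation "lookup \<equiv> Poly_Mapping.lookup"
abbreviation "keys \<equiv> Poly_Mapping.keys"
abbreviation "single \<equiv> Poly_Mapping.single"

section \<open>The polynomial ring as an algebraic structure, and its ideals\<close>

lemma mpoly_ring_simps [simp]:
  "carrier mpoly_ring = UNIV" "monoid.mult mpoly_ring = (*)" "monoid.one mpoly_ring = 1"
  "ring.zero mpoly_ring = 0" "ring.add mpoly_ring = (+)"
  by (simp_all add: mpoly_ring_def)

lemma cring_mpoly_ring: "cring (mpoly_ring :: ('n, 'k::field) mpoly ring)"
proof (rule cringI)
  show "abelian_group (mpoly_ring :: ('n, 'k) mpoly ring)"
  proof (rule abelian_groupI)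
    fix f :: "('n, 'k) mpoly"
    show "\<exists>g\<in>carrier mpoly_ring. g \<oplus>\<^bsub>mpoly_ring\<^esub> f = \<zero>\<^bsub>mpoly_ring\<^esub>"
      by (rule bexI[of _ "- f"]) simp_all
  qed (simp_all add: algebra_simps)
  show "comm_monoid (mpoly_ring :: ('n, 'k) mpoly ring)"
    by (rule comm_monoidI) (simp_all add: algebra_simps)
qed (simp_all add: algebra_simps)

lemma ring_mpoly_ring: "ring (mpoly_ring :: ('n, 'k::field) mpoly ring)"
  using cring_mpoly_ring cring.axioms(1) by blast

lemma mpoly_ideal_add:
  assumes "ideal J (mpoly_ring :: ('n, 'k::field) mpoly ring)" "f \<in> J" "g \<in> J"
  shows "f + g \<in> J"
  using additive_subgroup.a_closed[OF ideal.axioms(1)[OF assms(1)] assms(2,3)] by simp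

lemma mpoly_ideal_zero:
  assumes "ideal J (mpoly_ring :: ('n, 'k::field) mpoly ring)"
  shows "0 \<in> J"
  using additive_subgroup.zero_closed[OF ideal.axioms(1)[OF assms]] by simp

lemma mpoly_ideal_mult:
  assumes "ideal J (mpoly_ring :: ('n, 'k::field) mpoly ring)" "f \<in> J"
  shows "g * f \<in> J"
  using ideal.I_l_closed[OF assms, of g] by simp

lemma mpoly_ideal_diff:
  assumes "ideal J (mpoly_ring :: ('n, 'k::field) mpoly ring)" "f \<in> J" "g \<in> J"
  shows "f - g \<in> J"
  using mpoly_ideal_add[OF assms(1,2) mpoly_ideal_mult[OF assms(1,3), of "-1"]] by simp

lemma mpoly_ideal_sum:
  assumes "ideal J (mpoly_ring :: ('n, 'k::field) mpoly ring)" "\<And>a. a \<in> A \<Longrightarrow> f a \<in> J"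
  shows "sum f A \<in> J"
  using assms(2)
  by (induction A rule: infinite_finite_induct)
    (auto intro: mpoly_ideal_zero mpoly_ideal_add assms(1))

lemma mpoly_idealI:
  assumes "0 \<in> J" "\<And>f g. f \<in> J \<Longrightarrow> g \<in> J \<Longrightarrow> f + g \<in> J"
    "\<And>f g. f \<in> J \<Longrightarrow> g * f \<in> J"
  shows "ideal J (mpoly_ring :: ('n, 'k::field) mpoly ring)"
proof (rule idealI[OF ring_mpoly_ring])
  interpret ring "mpoly_ring :: ('n, 'k) mpoly ring" by (rule ring_mpoly_ring)
  have minus: "\<ominus>\<^bsub>mpoly_ring\<^esub> f = - f" for f :: "('n, 'k) mpoly"
    by (rule minus_equality) simp_all
  have "- f \<in> J" if "f \<in> J" for f
    using assms(3)[OF that, of "-1"] by simp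
  then show "subgroup J (add_monoid (mpoly_ring :: ('n, 'k) mpoly ring))"
    using assms(1,2) minus by (intro add.subgroupI) (auto simp: a_inv_def)
next
  fix f g assume "f \<in> J"
  then show "f \<otimes>\<^bsub>mpoly_ring\<^esub> g \<in> J" "g \<otimes>\<^bsub>mpoly_ring\<^esub> f \<in> J"
    using assms(3)[of f g] by (simp_all add: mult.commute)
qed

section \<open>Homogeneous components and degrees of monomials\<close>

lemma mem_forms_iff: "f \<in> forms i \<longleftrightarrow> (\<forall>m. lookup f m \<noteq> 0 \<longrightarrow> int (mdeg m) = i)"
  by (auto simp: forms_def in_keys_iff)

lemma lookup_hom_component:
  "lookup (hom_component i f) m = (lookup f m when int (mdeg m) = i)"
  for f :: "('n::finite, 'k::field) mpoly"
proof -
  have "lookup (hom_component i f) m =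
      (\<Sum>m' | m' \<in> keys f \<and> int (mdeg m') = i. if m' = m then lookup f m' else 0)"
    unfolding hom_component_def lookup_sum
    by (intro sum.cong) (auto simp: lookup_single when_def)
  also have "\<dots> = (lookup f m when int (mdeg m) = i)"
    by (subst sum.delta) (auto simp: in_keys_iff when_def)
  finally show ?thesis .
qed

lemma hom_component_in_forms [simp]: "hom_component i f \<in> forms i"
  by (simp add: mem_forms_iff lookup_hom_component)

lemma hom_component_forms: "f \<in> forms i \<Longrightarrow> hom_component i f = f"
  by (intro poly_mapping_eqI) (auto simp: lookup_hom_component mem_forms_iff when_def)

lemma sum_hom_components:
  "f = (\<Sum>j\<in>mdeg ` keys f. hom_component (int j) f)"
  by (intro poly_mapping_eqI)
    (auto simp: lookup_sum lookup_hom_component when_def in_keys_iff image_iff)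

lemma mdeg_add: "mdeg (m + m') = mdeg m + mdeg m'"
  by (simp add: mdeg_def lookup_add sum.distrib)

lemma mdeg_zero [simp]: "mdeg 0 = 0"
  by (simp add: mdeg_def)

lemma mdeg_single [simp]: "mdeg (single i a) = a"
  by (simp add: mdeg_def lookup_single when_def)

lemma mdeg_eq_0_iff [simp]: "mdeg m = 0 \<longleftrightarrow> m = 0"
  by (auto simp: mdeg_def intro: poly_mapping_eqI)

lemma mdeg_1E:
  assumes "mdeg m = 1"
  obtains i where "m = single i 1"
proof -
  have "m \<noteq> 0" using assms by auto
  then obtain i where i: "lookup m i \<noteq> 0"
    by (metis poly_mapping_eqI lookup_zero)
  have eq: "m = (m - single i 1) + single i 1"
    using i by (intro poly_mapping_eqI) (auto simp: lookup_add lookup_minus lookup_single when_def)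
  then have "mdeg (m - single i 1) = 0"
    using mdeg_add[of "m - single i 1" "single i 1"] assms by simp
  then show ?thesis using that[of i] eq by simp
qed

lemma mpoly_eq_sum_single: "(f :: ('n, 'k::field) mpoly) = (\<Sum>m\<in>keys f. single m (lookup f m))"
  by (intro poly_mapping_eqI) (auto simp: lookup_sum lookup_single when_def in_keys_iff)

lemma lookup_single_mult:
  "lookup (single m c * g) (m + e) = c * lookup g e"
  for g :: "('n, 'k::field) mpoly"
proof -
  have "lookup (single m c * g) (m + e) = (\<Sum>e'\<in>keys g. lookup (single m c * single e' (lookup g e')) (m + e))"
    by (subst mpoly_eq_sum_single[of g]) (simp add: sum_distrib_left lookup_sum)
  also have "\<dots> = (\<Sum>e'\<in>keys g. if e' = e then c * lookup g e' else 0)"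
    by (intro sum.cong) (auto simp: mult_single lookup_single when_def)
  also have "\<dots> = c * lookup g e"
    by (auto simp: in_keys_iff)
  finally show ?thesis .
qed

lemma keys_mult_subset:
  fixes f g :: "('n, 'k::field) mpoly"
  assumes "lookup (f * g) k \<noteq> 0"
  obtains m e where "lookup f m \<noteq> 0" "lookup g e \<noteq> 0" "k = m + e"
proof -
  have "lookup (f * g) k = (\<Sum>m\<in>keys f. \<Sum>e\<in>keys g. (lookup f m * lookup g e when m + e = k))"
    by (subst mpoly_eq_sum_single[of f], subst mpoly_eq_sum_single[of g])
      (simp add: sum_distrib_left sum_distrib_right lookup_sum mult_single lookup_single
        sum.swap[of _ "keys f"])
  with assms obtain m where "m \<in> keys f" "(\<Sum>e\<in>keys g. (lookup f m * lookup g e when m + e = k)) \<noteq> 0"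
    by (metis (no_types, lifting) sum.neutral)
  then obtain e where "e \<in> keys g" "(lookup f m * lookup g e when m + e = k) \<noteq> 0"
    by (metis (no_types, lifting) sum.neutral)
  with \<open>m \<in> keys f\<close> that show ?thesis by (auto simp: in_keys_iff)
qed

text \<open>Polynomials and divided power elements share one type, so the vector space
  \<open>dp\<close> serves for \<open>R\<close> as well. This identity links its scaling to the ring
  multiplication.\<close>

lemma const_mult: "const c * f = dp_scale c f"
  unfolding const_def
  by (intro poly_mapping_eqI)
    (use lookup_single_mult[of 0 c f] in \<open>simp add: lookup_dp_scale\<close>)

lemma const_simps [simp]: "const 0 = 0" "const 1 = 1"
  "const (a + b) = const a + const b" "const (a * b) = const a * const b"
  by (simp_all add: const_def single_add mult_single)

lemma forms_0_eq: "(forms 0 :: ('n::finite, 'k::field) mpoly set) = range const"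
proof (intro equalityI subsetI)
  fix f :: "('n, 'k) mpoly" assume "f \<in> forms 0"
  then have "f = const (lookup f 0)"
    by (intro poly_mapping_eqI) (auto simp: const_def lookup_single when_def mem_forms_iff)
  then show "f \<in> range const" by blast
qed (auto simp: const_def mem_forms_iff lookup_single when_def split: if_splits)

lemma single_in_forms [simp]: "int (mdeg m) = i \<Longrightarrow> single m c \<in> forms i"
  by (auto simp: mem_forms_iff lookup_single when_def)

lemma forms_mult:
  assumes "f \<in> forms i" "g \<in> forms j"
  shows "f * g \<in> forms (i + j)"
  unfolding mem_forms_iff
proof (intro allI impI)
  fix k assume "lookup (f * g) k \<noteq> 0"
  then obtain m e where "lookup f m \<noteq> 0" "lookup g e \<noteq> 0" "k = m + e"
    by (rule keys_mult_subset)
  with assms show "int (mdeg k) = i + j" by (simp add: mem_forms_iff mdeg_add)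
qed

lemma forms_neg: "i < 0 \<Longrightarrow> forms i = {0}"
  by (auto simp: forms_def)

lemma subspace_forms: "dp.subspace (forms i :: ('n::finite, 'k::field) mpoly set)"
proof (rule dp.subspaceI)
  fix f g :: "('n, 'k) mpoly" assume "f \<in> forms i" "g \<in> forms i"
  then show "f + g \<in> forms i"
    unfolding mem_forms_iff lookup_add by (metis add_cancel_left_left)
qed (auto simp: mem_forms_iff lookup_dp_scale)

lemma forms_diff: "f \<in> forms i \<Longrightarrow> g \<in> forms i \<Longrightarrow> f - g \<in> forms i"
  by (rule dp.subspace_diff[OF subspace_forms])

lemma finite_mdeg: "finite {m :: 'n::finite \<Rightarrow>\<^sub>0 nat. int (mdeg m) = i}"
proof (rule finite_imageD)
  have "lookup ` {m :: 'n \<Rightarrow>\<^sub>0 nat. int (mdeg m) = i} \<subseteq> (\<Pi>\<^sub>E j\<in>UNIV. {..nat i})"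
  proof -
    have "lookup m j \<le> mdeg m" for m :: "'n \<Rightarrow>\<^sub>0 nat" and j
      unfolding mdeg_def by (rule member_le_sum) auto
    then show ?thesis by auto
  qed
  then show "finite (lookup ` {m :: 'n \<Rightarrow>\<^sub>0 nat. int (mdeg m) = i})"
    by (rule finite_subset) (auto intro: finite_PiE)
qed (simp add: inj_on_def poly_mapping.lookup_inject)

lemma mpoly_span_single: "f \<in> dp.span ((\<lambda>m. single m 1) ` keys f)"
proof -
  have "single m c = dp_scale c (single m 1)" for m and c :: 'b
    by (intro poly_mapping_eqI) (simp add: lookup_dp_scale lookup_single when_def)
  then have "(\<Sum>m\<in>keys f. single m (lookup f m)) \<in> dp.span ((\<lambda>m. single m 1) ` keys f)"
    by (metis (no_types, lifting) dp.span_sum dp.span_scale dp.span_base imageI)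
  then show ?thesis using mpoly_eq_sum_single[of f] by simp
qed

lemma forms_eq_span:
  "(forms i :: ('n::finite, 'k::field) mpoly set) = dp.span ((\<lambda>m. single m 1) ` {m. int (mdeg m) = i})" (is "?L = ?R")
proof
  show "?L \<subseteq> ?R"
  proof
    fix f :: "('n, 'k) mpoly" assume "f \<in> forms i"
    then have "(\<lambda>m. single m (1::'k)) ` keys f \<subseteq> (\<lambda>m. single m 1) ` {m. int (mdeg m) = i}"
      by (auto simp: forms_def)
    then show "f \<in> dp.span ((\<lambda>m. single m 1) ` {m. int (mdeg m) = i})"
      using mpoly_span_single dp.span_mono by blast
  qed
  show "?R \<subseteq> ?L"
    by (rule dp.span_minimal[OF _ subspace_forms]) auto
qed

text \<open>A leading-term argument in one variable: if \<open>i\<close> is a variable of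
  \<open>l\<close> and \<open>e\<close> a monomial of \<open>f\<close> with the largest exponent at
  \<open>i\<close>, the other terms of \<open>l\<close> are other variables and cannot raise that
  exponent. This gives injectivity in the degrees below \<open>d\<close>.\<close>

lemma linear_form_mult_eq_0:
  fixes l f :: "('n::finite, 'k::field) mpoly"
  assumes l: "l \<in> forms 1" "l \<noteq> 0" and "l * f = 0"
  shows "f = 0"
proof (rule ccontr)
  assume "f \<noteq> 0"
  obtain m where m: "lookup l m \<noteq> 0"
    using l(2) by (metis poly_mapping_eqI lookup_zero)
  then have "mdeg m = 1" using l(1) by (auto simp: mem_forms_iff)
  then obtain i where i: "m = single i 1" by (rule mdeg_1E)
  have "keys f \<noteq> {}" using \<open>f \<noteq> 0\<close> by simp
  then obtain e where e: "e \<in> keys f" "lookup e i = Max ((\<lambda>e. lookup e i) ` keys f)"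
    using Max_in[of "(\<lambda>e. lookup e i) ` keys f"] by (auto simp: image_iff)
  have e_max: "lookup e' i \<le> lookup e i" if "e' \<in> keys f" for e'
    unfolding e(2) using that by (intro Max_ge) auto
  \<comment> \<open>\<open>e\<close> has maximal exponent of the variable \<open>i\<close>, so that \<open>m + e\<close> arises only once in \<open>l * f\<close>\<close>
  define l' where "l' = l - single m (lookup l m)"
  have "lookup (l' * f) (m + e) = 0"
  proof (rule ccontr)
    assume "lookup (l' * f) (m + e) \<noteq> 0"
    then obtain m' e' where *: "lookup l' m' \<noteq> 0" "lookup f e' \<noteq> 0" "m + e = m' + e'"
      by (rule keys_mult_subset)
    then have "m' \<noteq> m" "lookup l m' \<noteq> 0"
      by (auto simp: l'_def lookup_minus lookup_single when_def split: if_splits)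
    then have "mdeg m' = 1" using l(1) by (auto simp: mem_forms_iff)
    then obtain j where j: "m' = single j 1" by (rule mdeg_1E)
    have "j \<noteq> i" using \<open>m' \<noteq> m\<close> i j by blast
    have "lookup (m + e) i = Suc (lookup e i)"
      unfolding i by (simp add: lookup_add)
    moreover have "lookup (m' + e') i = lookup e' i"
      unfolding j using \<open>j \<noteq> i\<close> by (simp add: lookup_add lookup_single)
    ultimately have "lookup e' i = Suc (lookup e i)" using *(3) by metis
    with e_max[of e'] *(2) show False by (simp add: in_keys_iff)
  qed
  moreover have "l * f = single m (lookup l m) * f + l' * f"
    by (simp add: l'_def algebra_simps)
  ultimately have "lookup (l * f) (m + e) = lookup l m * lookup f e"
    by (simp add: lookup_add lookup_single_mult)
  with m e(1) \<open>l * f = 0\<close> show False by (simp add: in_keys_iff)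
qed

section \<open>Dimensions in the quotient algebra\<close>

lemma (in ring) dimension_mono:
  assumes "subfield K R" "dimension n K E" "dimension m K F" "E \<subseteq> F"
  shows "n \<le> m"
proof -
  obtain Vs where Vs: "independent K Vs" "length Vs = n" "Span K Vs = E" "set Vs \<subseteq> carrier R"
    using exists_base[OF assms(1,2)] by blast
  have "set Vs \<subseteq> F"
    using Span_base_incl[OF assms(1) Vs(4)] Vs(3) assms(4) by blast
  then show ?thesis
    using independent_length_le_dimension[OF assms(1,3) Vs(1)] Vs(2) by blast
qed

lemma (in ring) finite_dimension_in_carrier:
  assumes "subfield K R" "dimension n K E"
  shows "E \<subseteq> carrier R"
  using subalgebra_in_carrier[OF finite_dimension_imp_subalgebra[OF assms(1) finite_dimensionI[OF assms(2)]]] .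

text \<open>The successor rule of \<open>dimension\<close> only adjoins vectors from outside the
  subspace; this covers the opposite case, which arises when images of independent vectors become
  dependent.\<close>

lemma (in ring) line_extension_absorb:
  assumes K: "subfield K R" and dim: "dimension n K E" and v: "v \<in> E"
  shows "line_extension K v E = E"
proof -
  have sub: "subalgebra K E R"
    by (rule finite_dimension_imp_subalgebra[OF K finite_dimensionI[OF dim]])
  have carr: "E \<subseteq> carrier R" by (rule finite_dimension_in_carrier[OF K dim])
  have add: "u \<oplus> w \<in> E" if "u \<in> E" "w \<in> E" for u w
    using subgroup.m_closed[OF subalgebra.axioms(1)[OF sub] that] by simp
  have zero: "\<zero> \<in> K" using subringE(2)[OF subfieldE(1)[OF K]] .
  have "w \<in> line_extension K v E" if "w \<in> E" for w
    unfolding line_extension_mem_iff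
    by (rule bexI[OF bexI[OF _ that] zero]) (use subsetD[OF carr that] subsetD[OF carr v] in simp)
  moreover have "w \<in> E" if "w \<in> line_extension K v E" for w
    using that v add subalgebra.smult_closed[OF sub] unfolding line_extension_mem_iff by blast
  ultimately show ?thesis by blast
qed

text \<open>Induction along a flag of \<open>E\<close>. Adjoining \<open>v\<close> either leaves the
  image unchanged or raises its dimension by one. The first case means
  \<open>a \<otimes> v = a \<otimes> w\<close> for some \<open>w\<close> in \<open>E\<close>, while
  \<open>v\<close> is outside \<open>E\<close>, so it contradicts injectivity.\<close>

lemma (in cring) dimension_mult_image:
  assumes K: "subfield K R" and a: "a \<in> carrier R" and dim: "dimension n K E"
  shows "\<exists>m\<le>n. dimension m K ((\<otimes>) a ` E) \<and> (inj_on ((\<otimes>) a) E \<longrightarrow> m = n)"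
  using dim K
proof (induction rule: dimension.induct)
  case (zero_dim K)
  have "(\<otimes>) a ` {\<zero>} = {\<zero>}" using a by simp
  then show ?case by auto
next
  case (Suc_dim v E n K)
  then obtain m where m: "m \<le> n" "dimension m K ((\<otimes>) a ` E)"
    "inj_on ((\<otimes>) a) E \<longrightarrow> m = n" by blast
  have E: "E \<subseteq> carrier R" using finite_dimension_in_carrier Suc_dim by blast
  have K_carr: "K \<subseteq> carrier R" using subfieldE(3)[OF Suc_dim.prems] .
  have distr: "a \<otimes> (k \<otimes> v \<oplus> w) = k \<otimes> (a \<otimes> v) \<oplus> a \<otimes> w" if "k \<in> K" "w \<in> E" for k w
  proof -
    have "k \<in> carrier R" "w \<in> carrier R" using that K_carr E by auto
    then show ?thesis using a Suc_dim.hyps(1) by (simp add: r_distr m_lcomm)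
  qed
  have img: "(\<otimes>) a ` line_extension K v E = line_extension K (a \<otimes> v) ((\<otimes>) a ` E)"
  proof (intro equalityI subsetI)
    fix u assume "u \<in> (\<otimes>) a ` line_extension K v E"
    then obtain k w where "k \<in> K" "w \<in> E" "u = a \<otimes> (k \<otimes> v \<oplus> w)"
      by (auto simp: line_extension_mem_iff)
    then show "u \<in> line_extension K (a \<otimes> v) ((\<otimes>) a ` E)"
      using distr by (auto simp: line_extension_mem_iff)
  next
    fix u assume "u \<in> line_extension K (a \<otimes> v) ((\<otimes>) a ` E)"
    then obtain k w where kw: "k \<in> K" "w \<in> E" "u = k \<otimes> (a \<otimes> v) \<oplus> a \<otimes> w"
      by (auto simp: line_extension_mem_iff)
    then have "u = a \<otimes> (k \<otimes> v \<oplus> w)" using distr by simp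
    moreover have "k \<otimes> v \<oplus> w \<in> line_extension K v E"
      using kw unfolding line_extension_mem_iff by blast
    ultimately show "u \<in> (\<otimes>) a ` line_extension K v E" by blast
  qed
  have zero: "\<zero> \<in> K" and one: "\<one> \<in> K"
    using subringE(2,3)[OF subfieldE(1)[OF Suc_dim.prems]] by auto
  have zeroE: "\<zero> \<in> E"
    using subgroup.one_closed[OF subalgebra.axioms(1)[OF finite_dimension_imp_subalgebra[OF
      Suc_dim.prems finite_dimensionI[OF Suc_dim.hyps(3)]]]] by simp
  have E_sub: "E \<subseteq> line_extension K v E"
  proof
    fix w assume w: "w \<in> E"
    have "w = \<zero> \<otimes> v \<oplus> w" using subsetD[OF E w] Suc_dim.hyps(1) by simp
    then show "w \<in> line_extension K v E"
      unfolding line_extension_mem_iff using w zero by blast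
  qed
  have "v = \<one> \<otimes> v \<oplus> \<zero>" using Suc_dim.hyps(1) by simp
  then have v_in: "v \<in> line_extension K v E"
    unfolding line_extension_mem_iff using one zeroE by blast
  show ?case
  proof (cases "a \<otimes> v \<in> (\<otimes>) a ` E")
    case True
    then have "\<not> inj_on ((\<otimes>) a) (line_extension K v E)"
      using E_sub v_in Suc_dim.hyps(2) unfolding inj_on_def by blast
    moreover have "m \<le> Suc n" using m(1) by simp
    ultimately show ?thesis
      using m(2) unfolding img line_extension_absorb[OF Suc_dim.prems m(2) True] by blast
  next
    case False
    have "dimension (Suc m) K ((\<otimes>) a ` line_extension K v E)"
      unfolding img by (rule dimension.intros(2)[OF _ False m(2)]) (use a Suc_dim.hyps(1) in simp)
    moreover have "Suc m \<le> Suc n" using m(1) by simp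
    moreover have "inj_on ((\<otimes>) a) (line_extension K v E) \<longrightarrow> Suc m = Suc n"
      using m(3) inj_on_subset[OF _ E_sub] by blast
    ultimately show ?thesis by blast
  qed
qed

lemma subfield_range_const:
  "subfield (range const) (mpoly_ring :: ('n, 'k::field) mpoly ring)"
proof -
  interpret R: cring "mpoly_ring :: ('n, 'k) mpoly ring" by (rule cring_mpoly_ring)
  have minus: "\<ominus>\<^bsub>mpoly_ring\<^esub> f = - f" for f :: "('n, 'k) mpoly"
    by (rule R.minus_equality) simp_all
  have const_uminus: "- const c = const (- c)" for c :: 'k
    by (simp add: const_def single_uminus)
  have "subcring (range const) (mpoly_ring :: ('n, 'k) mpoly ring)"
  proof (rule R.subcringI, rule R.subringI)
    show "\<one>\<^bsub>mpoly_ring\<^esub> \<in> range (const :: 'k \<Rightarrow> ('n, 'k) mpoly)"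
      by (metis const_simps(2) mpoly_ring_simps(3) rangeI)
    fix f g :: "('n, 'k) mpoly"
    assume f: "f \<in> range const"
    then show "\<ominus>\<^bsub>mpoly_ring\<^esub> f \<in> range const"
      by (auto simp: minus const_uminus)
    assume g: "g \<in> range const"
    show "f \<otimes>\<^bsub>mpoly_ring\<^esub> g \<in> range const" "f \<oplus>\<^bsub>mpoly_ring\<^esub> g \<in> range const"
      using f g by (auto simp flip: const_simps)
  qed (auto simp: algebra_simps)
  moreover have "Units (mpoly_ring \<lparr>carrier := range const\<rparr>) =
      range (const :: 'k \<Rightarrow> ('n, 'k) mpoly) - {\<zero>\<^bsub>mpoly_ring\<^esub>}"
  proof -
    have "\<exists>d. const d * const c = (1 :: ('n, 'k) mpoly)" if "const c \<noteq> (0 :: ('n, 'k) mpoly)" for c :: 'k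
    proof (rule exI[of _ "inverse c"])
      have "c \<noteq> 0" using that by auto
      then show "const (inverse c) * const c = (1 :: ('n, 'k) mpoly)"
        by (simp flip: const_simps)
    qed
    then show ?thesis
      by (auto simp: Units_def mult.commute)
  qed
  ultimately show ?thesis
    by (rule R.subfieldI)
qed

section \<open>The quotient by an ideal and the dimensions of its graded components\<close>

locale mpoly_ideal =
  fixes I :: "('n::finite, 'k::field) mpoly set"
  assumes ideal_I: "ideal I mpoly_ring"
begin

sublocale ideal I mpoly_ring by (rule ideal_I)

lemma residue_class_eq: "residue_class I = (+>\<^bsub>mpoly_ring\<^esub>) I"
  by (simp add: fun_eq_iff residue_class_def)

text \<open>With the residue map as a homomorphism, the linear algebra of the quotient ring becomes
  available under the prefix \<open>res.S\<close>.\<close>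

sublocale res: ring_hom_cring mpoly_ring "quotient_algebra I" "residue_class I"
  unfolding residue_class_eq by (rule rcos_ring_hom_cring[OF cring_mpoly_ring])

lemma residue_eq_iff: "residue_class I f = residue_class I g \<longleftrightarrow> f - g \<in> I"
proof -
  have eq: "residue_class I f = {i + f | i. i \<in> I}" for f
    by (auto simp: residue_class_def a_r_coset_def')
  show ?thesis
  proof
    assume *: "residue_class I f = residue_class I g"
    have "f \<in> residue_class I f"
      using mpoly_ideal_zero[OF ideal_I] by (force simp: eq)
    then have "f \<in> residue_class I g" using * by simp
    then show "f - g \<in> I" by (auto simp: eq)
  next
    assume fg: "f - g \<in> I"
    have "i + f = (i + (f - g)) + g" "i + g = (i - (f - g)) + f" for i by simp_all
    then show "residue_class I f = residue_class I g"
      unfolding eq using mpoly_ideal_add[OF ideal_I _ fg] mpoly_ideal_diff[OF ideal_I _ fg]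
      by blast
  qed
qed

lemma residue_eq_zero_iff: "residue_class I f = \<zero>\<^bsub>quotient_algebra I\<^esub> \<longleftrightarrow> f \<in> I"
  using residue_eq_iff[of f 0] res.hom_zero by simp

lemma carrier_quotient: "carrier (quotient_algebra I) = range (residue_class I)"
  by (auto simp: FactRing_def A_RCOSETS_def' residue_class_def)

lemma residue_add:
  "residue_class I (f + g) = residue_class I f \<oplus>\<^bsub>quotient_algebra I\<^esub> residue_class I g"
  using res.hom_add[of f g] by simp

lemma residue_mult:
  "residue_class I (f * g) = residue_class I f \<otimes>\<^bsub>quotient_algebra I\<^esub> residue_class I g"
  using res.hom_mult[of f g] by simp

lemma quotient_action_residue: "quotient_action I f (residue_class I g) = residue_class I (f * g)"
  by (simp add: quotient_action_def residue_mult)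

definition scalars :: "('n, 'k) mpoly set set" where
  "scalars = range (\<lambda>c. residue_class I (const c))"

text \<open>The image of a field under a ring homomorphism is a field as soon as the target is
  nonzero, which is what \<open>1 \<notin> I\<close> provides.\<close>

lemma subfield_scalars:
  assumes "1 \<notin> I"
  shows "subfield scalars (quotient_algebra I)"
proof -
  have "scalars = residue_class I ` range const"
    by (auto simp: scalars_def)
  moreover have "\<one>\<^bsub>quotient_algebra I\<^esub> \<noteq> \<zero>\<^bsub>quotient_algebra I\<^esub>"
    using assms residue_eq_zero_iff[of 1] res.hom_one by simp
  ultimately show ?thesis
    using ring_hom_ring.img_is_subfield(2)[OF rcos_ring_hom_ring subfield_range_const]
    by (simp add: residue_class_eq)
qed

text \<open>The generators are adjoined one at a time. Their residues may be dependent modulo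
  \<open>I\<close>, so each either is absorbed or adds one to the dimension, and only the existence
  of a dimension is claimed.\<close>

lemma dimension_residue_span:
  assumes "1 \<notin> I" "finite M"
  shows "\<exists>n. res.S.dimension n scalars (residue_class I ` dp.span M)"
  using assms(2)
proof (induction M rule: finite_induct)
  case empty
  have "residue_class I ` dp.span {} = {\<zero>\<^bsub>quotient_algebra I\<^esub>}"
    using res.hom_zero by simp
  then show ?case using res.S.dimension.intros(1) by metis
next
  case (insert v M)
  then obtain n where n: "res.S.dimension n scalars (residue_class I ` dp.span M)" by blast
  have *: "residue_class I (const c * f + g) = residue_class I (const c)
      \<otimes>\<^bsub>quotient_algebra I\<^esub> residue_class I f \<oplus>\<^bsub>quotient_algebra I\<^esub> residue_class I g" for c f g
    by (simp add: residue_add residue_mult)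
  have "residue_class I ` dp.span (insert v M) =
      res.S.line_extension scalars (residue_class I v) (residue_class I ` dp.span M)"
  proof (intro equalityI subsetI)
    fix u assume "u \<in> residue_class I ` dp.span (insert v M)"
    then obtain f c where "f - dp_scale c v \<in> dp.span M" "u = residue_class I f"
      by (auto simp: dp.span_insert)
    moreover have "f = const c * v + (f - dp_scale c v)" by (simp add: const_mult)
    ultimately show "u \<in> res.S.line_extension scalars (residue_class I v) (residue_class I ` dp.span M)"
      unfolding res.S.line_extension_mem_iff scalars_def using *[of c v "f - dp_scale c v"] by auto
  next
    fix u assume "u \<in> res.S.line_extension scalars (residue_class I v) (residue_class I ` dp.span M)"
    then obtain c g where "g \<in> dp.span M" "u = residue_class I (const c * v + g)"
      unfolding res.S.line_extension_mem_iff scalars_def using * by auto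
    moreover from this(1) have "const c * v + g \<in> dp.span (insert v M)"
      by (auto simp: dp.span_insert const_mult intro!: exI[of _ c])
    ultimately show "u \<in> residue_class I ` dp.span (insert v M)" by blast
  qed
  moreover have "\<exists>n. res.S.dimension n scalars
      (res.S.line_extension scalars (residue_class I v) (residue_class I ` dp.span M))"
  proof (cases "residue_class I v \<in> residue_class I ` dp.span M")
    case True
    then show ?thesis
      using res.S.line_extension_absorb[OF subfield_scalars[OF assms(1)] n] n by auto
  next
    case False
    then show ?thesis using res.S.dimension.intros(2)[OF _ False n] by auto
  qed
  ultimately show ?case by simp
qed

lemma dimension_quotient_component:
  assumes "1 \<notin> I"
  shows "\<exists>n. res.S.dimension n scalars (quotient_component I i)"
  unfolding quotient_component_def forms_eq_span
  by (rule dimension_residue_span[OF assms]) (use finite_mdeg in auto)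

lemma quotient_dim_eqI:
  assumes "1 \<notin> I" "res.S.dimension n scalars V"
  shows "quotient_dim I V = n"
  using res.S.dimI[OF subfield_scalars assms(2)] assms(1)
  by (simp add: quotient_dim_def over_def scalars_def)

text \<open>The dimension \<open>m\<close> of the image is at most the dimension \<open>n\<close> of
  the source and, as the image lies in the target, at most its dimension \<open>p\<close>.
  Injectivity gives \<open>m = n\<close>, surjectivity gives \<open>p \<le> m\<close>; either way
  \<open>m\<close> is the minimum.\<close>

lemma mult_maximal_rankI:
  assumes "1 \<notin> I" "l \<in> forms 1"
    and "inj_on (quotient_action I l) (quotient_component I (i - 1)) \<or>
      quotient_component I i \<subseteq> quotient_action I l ` quotient_component I (i - 1)"
  shows "mult_maximal_rank I l i"
proof -
  let ?A = "quotient_component I (i - 1)" and ?B = "quotient_component I i"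
  note K = subfield_scalars[OF assms(1)]
  have act: "quotient_action I l = (\<otimes>\<^bsub>quotient_algebra I\<^esub>) (residue_class I l)"
    by (simp add: fun_eq_iff quotient_action_def)
  obtain n p where n: "res.S.dimension n scalars ?A" and p: "res.S.dimension p scalars ?B"
    using dimension_quotient_component[OF assms(1)] by blast
  obtain m where m: "m \<le> n" "res.S.dimension m scalars (quotient_action I l ` ?A)"
    "inj_on (quotient_action I l) ?A \<longrightarrow> m = n"
    using res.S.dimension_mult_image[OF K _ n, of "residue_class I l"] unfolding act by auto
  have sub: "quotient_action I l ` ?A \<subseteq> ?B"
    using forms_mult[OF assms(2), of _ "i - 1"]
    by (auto simp: quotient_component_def quotient_action_residue)
  have "m \<le> p" by (rule res.S.dimension_mono[OF K m(2) p sub])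
  moreover have "p \<le> m" if "?B \<subseteq> quotient_action I l ` ?A"
    by (rule res.S.dimension_mono[OF K p m(2) that])
  ultimately have "m = min n p" using assms(3) m(1,3) by (auto simp: min_def)
  then show ?thesis
    unfolding mult_maximal_rank_def
    using quotient_dim_eqI[OF assms(1)] n m(2) p by metis
qed

end

section \<open>Degrees in which the ideal or the quotient vanishes\<close>

text \<open>This is the \<open>i\<close>-th power of the maximal homogeneous ideal, described by its
  monomials instead of by products of ideals.\<close>

definition order_ideal :: "nat \<Rightarrow> ('n::finite, 'k::field) mpoly set" where
  "order_ideal i = {f. \<forall>m. lookup f m \<noteq> 0 \<longrightarrow> i \<le> mdeg m}"

lemma ideal_order_ideal:
  "ideal (order_ideal i) (mpoly_ring :: ('n::finite, 'k::field) mpoly ring)"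
proof (rule mpoly_idealI)
  fix f g :: "('n, 'k) mpoly"
  assume f: "f \<in> order_ideal i"
  show "f + g \<in> order_ideal i" if "g \<in> order_ideal i"
    unfolding order_ideal_def
  proof (intro CollectI allI impI)
    fix m assume "lookup (f + g) m \<noteq> 0"
    then have "lookup f m \<noteq> 0 \<or> lookup g m \<noteq> 0" by (auto simp: lookup_add)
    with f that show "i \<le> mdeg m" by (auto simp: order_ideal_def)
  qed
  show "g * f \<in> order_ideal i"
    unfolding order_ideal_def
  proof (intro CollectI allI impI)
    fix k assume "lookup (g * f) k \<noteq> 0"
    then obtain m e where "lookup g m \<noteq> 0" "lookup f e \<noteq> 0" "k = m + e"
      by (rule keys_mult_subset)
    with f show "i \<le> mdeg k" by (auto simp: order_ideal_def mdeg_add trans_le_add2)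
  qed
qed (simp add: order_ideal_def)

section \<open>Vanishing of the quotient in high degrees\<close>

lemma homogeneous_idealD:
  assumes "homogeneous_ideal I"
  shows "ideal I mpoly_ring" "f \<in> I \<Longrightarrow> hom_component i f \<in> I"
  using assms by (auto simp: homogeneous_ideal_def)

text \<open>The residues of the powers of the maximal homogeneous ideal form a descending chain.
  Once it is stationary, a form \<open>f\<close> of degree \<open>j\<close> is congruent modulo
  \<open>I\<close> to some \<open>g\<close> with all terms of degree above \<open>j\<close>. Then
  \<open>f\<close> is the component of degree \<open>j\<close> of \<open>f - g\<close>, and
  homogeneity puts it into \<open>I\<close>.\<close>

lemma artinian_forms_subset:
  fixes I :: "('n::finite, 'k::field) mpoly set"
  assumes "homogeneous_ideal I" "artinian_ring (quotient_algebra I)"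
  shows "\<exists>N. \<forall>j\<ge>N. forms (int j) \<subseteq> I"
proof -
  interpret mpoly_ideal I by (rule mpoly_ideal.intro[OF homogeneous_idealD(1)[OF assms(1)]])
  let ?J = "\<lambda>i. residue_class I ` order_ideal i"
  have "ideal (?J i) (quotient_algebra I)" for i
    using ring.ring_ideal_imp_quot_ideal[OF ring_mpoly_ring ideal_I ideal_order_ideal]
    unfolding residue_class_def .
  moreover have "?J (Suc i) \<subseteq> ?J i" for i
    by (intro image_mono) (auto simp: order_ideal_def Suc_le_eq)
  ultimately obtain N where N: "\<And>i. i \<ge> N \<Longrightarrow> ?J i = ?J N"
    using assms(2) unfolding artinian_ring_def by meson
  have "f \<in> I" if "j \<ge> N" and f: "f \<in> forms (int j)" for j and f :: "('n, 'k) mpoly"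
  proof -
    have "f \<in> order_ideal j" using f by (auto simp: mem_forms_iff order_ideal_def)
    then have "residue_class I f \<in> ?J j" by blast
    also have "\<dots> = ?J (Suc j)" using N[of j] N[of "Suc j"] that by simp
    finally obtain g where g: "g \<in> order_ideal (Suc j)" "f - g \<in> I"
      by (auto simp: residue_eq_iff)
    have "hom_component (int j) (f - g) = f"
    proof (rule poly_mapping_eqI)
      fix m
      show "lookup (hom_component (int j) (f - g)) m = lookup f m"
        using g(1) f by (auto simp: lookup_hom_component lookup_minus order_ideal_def mem_forms_iff when_def)
    qed
    then show ?thesis using homogeneous_idealD(2)[OF assms(1) g(2)] by metis
  qed
  then show ?thesis by blast
qed

text \<open>Let \<open>s\<close> be the largest degree in which \<open>A\<close> is nonzero. A
  nonzero class of degree \<open>s\<close> is killed by every form of positive degree, so it lies in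
  the socle; hence \<open>s\<close> is at most the top socle degree.\<close>

lemma forms_subset_above_socle_top_degree:
  fixes I :: "('n::finite, 'k::field) mpoly set"
  assumes hom: "homogeneous_ideal I" and "artinian_ring (quotient_algebra I)"
    and j: "socle_top_degree I < j"
  shows "forms (int j) \<subseteq> I"
proof (rule ccontr)
  assume nsub: "\<not> forms (int j) \<subseteq> I"
  interpret mpoly_ideal I by (rule mpoly_ideal.intro[OF homogeneous_idealD(1)[OF hom]])
  obtain N where N: "\<And>j. j \<ge> N \<Longrightarrow> forms (int j) \<subseteq> I"
    using artinian_forms_subset[OF assms(1,2)] by blast
  have bound: "k \<le> N" if "\<not> forms (int k) \<subseteq> I" for k
    using N[of k] that by (cases "k \<le> N") auto
  define s where "s = (GREATEST s. \<not> forms (int s) \<subseteq> I)"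
  have s: "\<not> forms (int s) \<subseteq> I"
    unfolding s_def by (rule GreatestI_nat[where P = "\<lambda>s. \<not> forms (int s) \<subseteq> I", OF nsub bound])
  have s_max: "k \<le> s" if "\<not> forms (int k) \<subseteq> I" for k
    unfolding s_def by (rule Greatest_le_nat[where P = "\<lambda>s. \<not> forms (int s) \<subseteq> I", OF that bound])
  obtain g where g: "g \<in> forms (int s)" "g \<notin> I" using s by blast
  have "f * g \<in> I" if "f \<in> irrelevant_ideal" for f
  proof -
    \<comment> \<open>As \<open>f\<close> has no constant term, only components of positive degree
      occur, and these push \<open>g\<close> beyond degree \<open>s\<close>.\<close>
    have "hom_component (int k) f * g \<in> I" if "k \<in> mdeg ` keys f" for k
    proof -
      have "k > 0"
        using that \<open>f \<in> irrelevant_ideal\<close> by (auto simp: irrelevant_ideal_def in_keys_iff intro: gr0I)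
      then have "forms (int (k + s)) \<subseteq> I" using s_max[of "k + s"] by auto
      then show ?thesis using forms_mult[OF hom_component_in_forms g(1), of "int k" f] by auto
    qed
    then have "(\<Sum>k\<in>mdeg ` keys f. hom_component (int k) f * g) \<in> I"
      by (intro mpoly_ideal_sum ideal_I) auto
    then show ?thesis by (simp flip: sum_distrib_right sum_hom_components)
  qed
  then have "residue_class I g \<in> socle I"
    by (auto simp: socle_def carrier_quotient quotient_action_residue residue_eq_zero_iff)
  moreover have "residue_class I g \<in> quotient_component I (int s)"
    using g(1) by (simp add: quotient_component_def)
  ultimately have *: "\<exists>u \<in> socle I \<inter> quotient_component I (int s). u \<noteq> \<zero>\<^bsub>quotient_algebra I\<^esub>"
    using g(2) residue_eq_zero_iff by blast
  have "s \<le> socle_top_degree I"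
    unfolding socle_top_degree_def
  proof (rule Greatest_le_nat[where P = "\<lambda>s. \<exists>u \<in> socle I \<inter> quotient_component I (int s).
      u \<noteq> \<zero>\<^bsub>quotient_algebra I\<^esub>", OF *])
    \<comment> \<open>\<open>GREATEST\<close> is only informative for a bounded predicate. A nonzero
      socle class of degree \<open>k\<close> comes from a form outside \<open>I\<close>, so
      \<open>N\<close> bounds these degrees.\<close>
    fix k assume "\<exists>u \<in> socle I \<inter> quotient_component I (int k). u \<noteq> \<zero>\<^bsub>quotient_algebra I\<^esub>"
    then obtain h where "h \<in> forms (int k)" "residue_class I h \<noteq> \<zero>\<^bsub>quotient_algebra I\<^esub>"
      unfolding quotient_component_def by blast
    then have "\<not> forms (int k) \<subseteq> I" using residue_eq_zero_iff by blast
    then show "k \<le> N" by (rule bound)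
  qed
  with s_max[OF nsub] j show False by simp
qed

section \<open>Homogeneous generators and vanishing of the ideal in low degrees\<close>

lemma finite_spanning_set_forms:
  fixes I :: "('n::finite, 'k::field) mpoly set"
  shows "\<exists>B. finite B \<and> B \<subseteq> I \<inter> forms i \<and> I \<inter> forms i \<subseteq> dp.span B"
proof -
  obtain B where B: "B \<subseteq> I \<inter> forms i" "dp.independent B" "I \<inter> forms i \<subseteq> dp.span B"
    using dp.maximal_independent_subset[of "I \<inter> forms i"] by metis
  have "B \<subseteq> dp.span ((\<lambda>m. single m 1) ` {m. int (mdeg m) = i})"
    using B(1) forms_eq_span by blast
  then have "finite B"
    using dp.independent_span_bound[OF _ B(2)] finite_mdeg by (metis finite_imageI)
  with B show ?thesis by blast
qed

lemma mpoly_ideal_span: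
  assumes "ideal J (mpoly_ring :: ('n, 'k::field) mpoly ring)" "B \<subseteq> J"
  shows "dp.span B \<subseteq> J"
proof (rule dp.span_minimal[OF assms(2)])
  show "dp.subspace J"
    by (rule dp.subspaceI)
      (use assms(1) in \<open>auto intro: mpoly_ideal_zero mpoly_ideal_add mpoly_ideal_mult simp flip: const_mult\<close>)
qed

text \<open>Finite spanning sets of the components of \<open>I\<close> up to degree \<open>N\<close>
  suffice: the component of degree \<open>N\<close> is all of \<open>forms (int N)\<close>, and
  every monomial of larger degree is a multiple of one of degree \<open>N\<close>.\<close>

lemma finite_homogeneous_generators:
  fixes I :: "('n::finite, 'k::field) mpoly set"
  assumes hom: "homogeneous_ideal I" and N: "\<And>j. j \<ge> N \<Longrightarrow> forms (int j) \<subseteq> I"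
  shows "\<exists>G. finite G \<and> (\<forall>g\<in>G. \<exists>i. g \<in> forms i) \<and> genideal mpoly_ring G = I"
proof -
  note ideal_I = homogeneous_idealD(1)[OF hom]
  have "\<forall>j. \<exists>B. finite B \<and> B \<subseteq> I \<inter> forms (int j) \<and> I \<inter> forms (int j) \<subseteq> dp.span B"
    by (simp only: finite_spanning_set_forms simp_thms)
  from choice[OF this] obtain B where
    "\<forall>j. finite (B j) \<and> B j \<subseteq> I \<inter> forms (int j) \<and> I \<inter> forms (int j) \<subseteq> dp.span (B j)"
    by (elim exE)
  then have B: "\<And>j. finite (B j)" "\<And>j. B j \<subseteq> I \<inter> forms (int j)"
    "\<And>j. I \<inter> forms (int j) \<subseteq> dp.span (B j)"
    by simp_all
  define G where "G = (\<Union>j\<le>N. B j)"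
  define J where "J = genideal mpoly_ring G"
  interpret ring "mpoly_ring :: ('n, 'k) mpoly ring" by (rule ring_mpoly_ring)
  have J: "ideal J mpoly_ring" "G \<subseteq> J"
    unfolding J_def using genideal_ideal genideal_self by auto
  have "J \<subseteq> I"
    unfolding J_def by (rule genideal_minimal[OF ideal_I]) (use B(2) in \<open>auto simp: G_def\<close>)
  have low: "I \<inter> forms (int j) \<subseteq> J" if "j \<le> N" for j
    using B(3)[of j] mpoly_ideal_span[OF J(1), of "B j"] J(2) that by (auto simp: G_def)
  \<comment> \<open>Induction on the excess \<open>k\<close> over \<open>N\<close>, splitting off
    one variable at a time.\<close>
  have high: "single m c \<in> J" if "mdeg m = N + k" for m c k
    using that
  proof (induction k arbitrary: m)
    case 0
    then have "single m c \<in> forms (int N)" by simp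
    then show ?case using low[of N] N[of N] by blast
  next
    case (Suc k)
    then have "m \<noteq> 0" by auto
    then obtain i where i: "lookup m i \<noteq> 0"
      by (metis poly_mapping_eqI lookup_zero)
    have eq: "m = single i 1 + (m - single i 1)"
      using i by (intro poly_mapping_eqI) (auto simp: lookup_add lookup_minus lookup_single when_def)
    then have "mdeg (m - single i 1) = N + k"
      using mdeg_add[of "single i 1" "m - single i 1"] Suc.prems by simp
    then have "single (single i 1) 1 * single (m - single i 1) c \<in> J"
      by (intro mpoly_ideal_mult[OF J(1)] Suc.IH)
    then show ?case using eq by (simp add: mult_single)
  qed
  have "f \<in> J" if "f \<in> I" for f
  proof -
    have "hom_component (int j) f \<in> J" for j
    proof (cases "j \<le> N")
      case True
      then show ?thesis
        using low[of j] homogeneous_idealD(2)[OF hom that, of "int j"] by auto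
    next
      case False
      show ?thesis
        unfolding hom_component_def
        by (rule mpoly_ideal_sum[OF J(1)])
          (use False high[of _ "j - N"] in auto)
    qed
    then have "(\<Sum>j\<in>mdeg ` keys f. hom_component (int j) f) \<in> J"
      by (intro mpoly_ideal_sum[OF J(1)])
    then show ?thesis by (simp flip: sum_hom_components)
  qed
  with \<open>J \<subseteq> I\<close> have "genideal mpoly_ring G = I" unfolding J_def by blast
  moreover have "finite G" using B(1) by (simp add: G_def)
  moreover have "\<forall>g\<in>G. \<exists>i. g \<in> forms i" using B(2) unfolding G_def by blast
  ultimately show ?thesis by blast
qed

text \<open>Let \<open>t\<close> be the least degree of a nonzero form in \<open>I\<close>. Any
  homogeneous generating set meets degree \<open>t\<close>, since otherwise all of \<open>I\<close>
  would have order above \<open>t\<close>. As \<open>initial_degree\<close> is a minimum over all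
  minimal generating sets, a single such set bounds it by \<open>t\<close>.\<close>

lemma forms_eq_0_below_initial_degree:
  fixes I :: "('n::finite, 'k::field) mpoly set"
  assumes hom: "homogeneous_ideal I" and art: "artinian_ring (quotient_algebra I)"
    and f: "f \<in> I" "f \<in> forms (int j)" and j: "j < initial_degree I"
  shows "f = 0"
proof (rule ccontr)
  assume "f \<noteq> 0"
  interpret ring "mpoly_ring :: ('n, 'k) mpoly ring" by (rule ring_mpoly_ring)
  define P where "P t \<longleftrightarrow> (\<exists>f\<in>I \<inter> forms (int t). f \<noteq> 0)" for t
  define t where "t = (LEAST t. P t)"
  have "P j" using f \<open>f \<noteq> 0\<close> by (auto simp: P_def)
  then have "P t" "t \<le> j" unfolding t_def by (rule LeastI, rule Least_le)
  then obtain h where h: "h \<in> I" "h \<in> forms (int t)" "h \<noteq> 0" by (auto simp: P_def)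
  obtain N where N: "\<And>j. j \<ge> N \<Longrightarrow> forms (int j) \<subseteq> I"
    using artinian_forms_subset[OF hom art] by blast
  let ?gen = "\<lambda>G. finite G \<and> (\<forall>g\<in>G. \<exists>i. g \<in> forms i) \<and> genideal mpoly_ring G = I"
  have "\<exists>G. ?gen G" by (rule finite_homogeneous_generators[OF hom N])
  then obtain G0 where "?gen G0" by (elim exE)
  \<comment> \<open>A finite generating set of least cardinality is minimal under inclusion, which
    produces a minimal generating set.\<close>
  then have "\<exists>G. ?gen G \<and> (\<forall>G'. ?gen G' \<longrightarrow> card G \<le> card G')"
    by (rule ex_has_least_nat[where P = ?gen])
  then obtain G where G: "?gen G" and G_min: "\<And>G'. ?gen G' \<Longrightarrow> card G \<le> card G'"
    by (elim exE conjE) simp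
  have min: "minimal_homogeneous_generators I G"
    unfolding minimal_homogeneous_generators_def
  proof (intro conjI allI impI notI)
    fix G' assume G': "G' \<subset> G" "genideal mpoly_ring G' = I"
    then have "finite G'" "\<forall>g\<in>G'. \<exists>i. g \<in> forms i"
      using G finite_subset[of G' G] by (simp, blast)
    then have "card G \<le> card G'" using G_min[of G'] G'(2) by simp
    moreover have "card G' < card G" using G psubset_card_mono[OF _ G'(1)] by simp
    ultimately show False by simp
  qed (use G in auto)
  have "G \<inter> forms (int t) \<noteq> {}"
  proof
    assume empty: "G \<inter> forms (int t) = {}"
    have "G \<subseteq> order_ideal (Suc t)"
    proof
      fix g assume g: "g \<in> G"
      then obtain i where i: "g \<in> forms i" using G by blast
      have "g \<in> I" using G g genideal_self[of G] by auto
      show "g \<in> order_ideal (Suc t)"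
        unfolding order_ideal_def
      proof (intro CollectI allI impI)
        fix m assume m: "lookup g m \<noteq> 0"
        then have "i = int (mdeg m)" using i by (auto simp: mem_forms_iff)
        moreover have "g \<noteq> 0" using m by auto
        ultimately have "P (mdeg m)" using i \<open>g \<in> I\<close> by (auto simp: P_def)
        then have "t \<le> mdeg m" unfolding t_def by (rule Least_le)
        moreover have "mdeg m \<noteq> t" using i g empty \<open>i = int (mdeg m)\<close> by auto
        ultimately show "Suc t \<le> mdeg m" by simp
      qed
    qed
    then have "I \<subseteq> order_ideal (Suc t)"
      using G genideal_minimal[OF ideal_order_ideal] by blast
    with h(1) have "lookup h m = 0" for m
      using h(2) by (force simp: order_ideal_def mem_forms_iff)
    then show False using h(3) by (metis poly_mapping_eqI lookup_zero)
  qed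
  with min have "initial_degree I \<le> t"
    unfolding initial_degree_def by (intro Least_le) blast
  with \<open>t \<le> j\<close> j show False by simp
qed

section \<open>Contraction and duality\<close>

text \<open>Contraction is adjoint to multiplication: the coefficient at \<open>e\<close> pairs
  \<open>F\<close> with \<open>f\<close> times the monomial \<open>e\<close>. The larger index set
  \<open>A\<close> allows for supports that shrink, as when \<open>f\<close> is multiplied by the
  constant 0.\<close>

lemma lookup_contract_superset:
  assumes "finite A" "keys f \<subseteq> A"
  shows "lookup (contract f F) e = (\<Sum>m\<in>A. lookup f m * lookup F (m + e))"
proof -
  have inner: "(\<Sum>e'\<in>keys F. lookup (if \<forall>i. lookup m i \<le> lookup e' i
      then single (e' - m) (lookup f m * lookup F e') else 0) e) = lookup f m * lookup F (m + e)" for m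
  proof -
    \<comment> \<open>Subtraction of exponents is truncated, so it can be inverted only together
      with the componentwise inequality.\<close>
    have "(\<forall>i. lookup m i \<le> lookup e' i) \<and> e' - m = e \<longleftrightarrow> e' = m + e" for e'
      by (auto simp: poly_mapping_eq_iff fun_eq_iff lookup_add lookup_minus)
        (metis le_add_diff_inverse)
    then have "lookup (if \<forall>i. lookup m i \<le> lookup e' i
        then single (e' - m) (lookup f m * lookup F e') else 0) e =
        (if e' = m + e then lookup f m * lookup F e' else 0)" for e'
      by (auto simp: lookup_single when_def)
    then show ?thesis by (simp add: in_keys_iff)
  qed
  have "lookup (contract f F) e = (\<Sum>m\<in>keys f. lookup f m * lookup F (m + e))"
    unfolding contract_def lookup_sum inner ..
  also have "\<dots> = (\<Sum>m\<in>A. lookup f m * lookup F (m + e))"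
    using assms by (intro sum.mono_neutral_left) (auto simp: in_keys_iff)
  finally show ?thesis .
qed

lemmas lookup_contract = lookup_contract_superset[OF finite_keys subset_refl]

lemma contract_const_mult: "contract (const c * f) F = contract f (dp_scale c F)"
proof (rule poly_mapping_eqI)
  fix e
  have *: "lookup (const c * f) m = c * lookup f m" for m
    by (simp add: const_mult lookup_dp_scale)
  then have "keys (const c * f) \<subseteq> keys f"
    by (auto simp: in_keys_iff)
  then show "lookup (contract (const c * f) F) e = lookup (contract f (dp_scale c F)) e"
    unfolding lookup_contract[of f] lookup_contract_superset[OF finite_keys \<open>keys (const c * f) \<subseteq> keys f\<close>]
      * lookup_dp_scale by (simp add: ac_simps)
qed

lemma contract_sum_right: "contract f (sum G A) = (\<Sum>a\<in>A. contract f (G a))"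
  by (rule poly_mapping_eqI)
    (simp add: lookup_contract lookup_sum sum_distrib_left sum.swap[of _ A])

text \<open>A basis of \<open>W\<close> stays independent when \<open>h\<close> is added, so values
  may be prescribed freely: 0 on the basis of \<open>W\<close> and 1 at \<open>h\<close>.\<close>

lemma separating_functional:
  fixes W :: "('n, 'k::field) dpoly set"
  assumes "dp.subspace W" "h \<notin> W"
  shows "\<exists>\<phi>. Vector_Spaces.linear dp_scale (*) \<phi> \<and> (\<forall>w\<in>W. \<phi> w = 0) \<and> \<phi> h = 1"
proof -
  interpret vector_space_pair "dp_scale :: 'k \<Rightarrow> ('n, 'k) dpoly \<Rightarrow> _" "(*) :: 'k \<Rightarrow> 'k \<Rightarrow> 'k"
    by unfold_locales (simp_all add: algebra_simps)
  obtain B where B: "B \<subseteq> W" "dp.independent B" "W \<subseteq> dp.span B"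
    using dp.maximal_independent_subset[of W] by metis
  have "dp.span B \<subseteq> W" by (rule dp.span_minimal[OF B(1) assms(1)])
  with assms(2) have "h \<notin> dp.span B" by blast
  then have "dp.independent (insert h B)" by (rule dp.independent_insertI[OF _ B(2)])
  then obtain \<phi> where \<phi>: "Vector_Spaces.linear dp_scale (*) \<phi>"
    "\<forall>b\<in>insert h B. \<phi> b = (if b = h then 1 else 0 :: 'k)"
    using linear_independent_extend[of "insert h B" "\<lambda>b. if b = h then 1 else 0"] by blast
  have "\<phi> b = 0" if "b \<in> B" for b
    using \<phi>(2) that \<open>h \<notin> dp.span B\<close> dp.span_base[of b B] by auto
  then have "\<phi> w = 0" if "w \<in> W" for w
    using linear_eq_0_on_span[OF \<phi>(1)] B(3) that by blast
  with \<phi> show ?thesis by auto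
qed

text \<open>The coefficients of \<open>F\<close> in the basis, each times \<open>l\<close>, form a
  linear syzygy, so each product is a constant times \<open>x\<close>. A nonzero coefficient could
  be divided out, making \<open>l\<close> itself a constant multiple of \<open>x\<close>.\<close>

lemma inverse_system_contract_injective:
  fixes I :: "('n::finite, 'k::field) mpoly set"
  assumes "narrow_direction d I x" and l: "l \<in> forms 1" "\<And>c. c \<in> forms 0 \<Longrightarrow> l \<noteq> x * c"
    and F: "F \<in> inverse_system I \<inter> dp_component (- int d)" "contract l F = 0"
  shows "F = 0"
proof -
  obtain Fs where Fs: "distinct Fs" "dp.span (set Fs) = inverse_system I \<inter> dp_component (- int d)"
    and syz: "linear_syzygies Fs \<subseteq>
      {map (\<lambda>c. x * c) cs | cs. length cs = length Fs \<and> set cs \<subseteq> forms 0}"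
    using assms(1) unfolding narrow_direction_def dp_basis_def by blast
  obtain u where u: "F = (\<Sum>v\<in>set Fs. dp_scale (u v) v)"
    using F(1) unfolding Fs(2)[symmetric] dp.span_finite[OF finite_set] by blast
  let ?ls = "map (\<lambda>v. const (u v) * l) Fs"
  have "(\<Sum>i<length Fs. contract (?ls ! i) (Fs ! i)) = (\<Sum>i<length Fs. contract l (dp_scale (u (Fs ! i)) (Fs ! i)))"
    by (intro sum.cong) (auto simp: contract_const_mult)
  \<comment> \<open>Coefficients are indexed by basis vectors but syzygies by list positions;
    distinctness of the list lets one pass between the two.\<close>
  also have "\<dots> = (\<Sum>v\<in>set Fs. contract l (dp_scale (u v) v))"
    by (rule sum.reindex_bij_betw[OF bij_betw_nth[OF Fs(1)]]) auto
  also have "\<dots> = contract l F"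
    by (simp add: u contract_sum_right)
  finally have "(\<Sum>i<length Fs. contract (?ls ! i) (Fs ! i)) = 0"
    using F(2) by simp
  moreover have "set ?ls \<subseteq> forms 1"
    using forms_mult[OF _ l(1), of _ 0] by (auto simp: forms_0_eq)
  ultimately have "?ls \<in> linear_syzygies Fs"
    by (simp add: linear_syzygies_def)
  then obtain cs where cs: "?ls = map (\<lambda>c. x * c) cs" "set cs \<subseteq> forms 0"
    using syz by blast
  have "u v = 0" if "v \<in> set Fs" for v
  proof (rule ccontr)
    assume "u v \<noteq> 0"
    have "const (u v) * l \<in> set (map (\<lambda>c. x * c) cs)"
      using that unfolding cs(1)[symmetric] by auto
    then obtain c where c: "c \<in> forms 0" "const (u v) * l = x * c" using cs(2) by auto
    have "const (inverse (u v)) * const (u v) = (1 :: ('n, 'k) mpoly)"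
      using \<open>u v \<noteq> 0\<close> const_simps(2,4) by (metis left_inverse)
    then have "l = const (inverse (u v)) * (const (u v) * l)"
      by (simp flip: mult.assoc)
    also have "\<dots> = x * (const (inverse (u v)) * c)"
      unfolding c(2) by (simp add: ac_simps)
    finally have "l = x * (const (inverse (u v)) * c)" .
    moreover have "const (inverse (u v)) * c \<in> forms 0"
      using forms_mult[OF _ c(1), of _ 0] by (auto simp: forms_0_eq)
    ultimately show False using l(2) by blast
  qed
  then show ?thesis by (simp add: u)
qed

text \<open>Macaulay duality: the cokernel of \<open>l\<close> in degree \<open>d\<close> is dual to the kernel of contraction by \<open>l\<close>.\<close>

lemma forms_subset_if_contract_injective:
  fixes I :: "('n::finite, 'k::field) mpoly set"
  assumes hom: "homogeneous_ideal I" and l: "l \<in> forms 1"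
    and inj: "\<And>F. F \<in> inverse_system I \<inter> dp_component (- int d) \<Longrightarrow> contract l F = 0 \<Longrightarrow> F = 0"
    and h: "h \<in> forms (int d)"
  shows "\<exists>f\<in>I. \<exists>g\<in>forms (int d - 1). h = f + l * g"
proof (rule ccontr)
  assume contra: "\<not> ?thesis"
  note ideal_I = homogeneous_idealD(1)[OF hom]
  \<comment> \<open>\<open>W\<close> is a subspace of all of \<open>R\<close> that constrains only
    the component of degree \<open>d\<close>. It contains every form of another degree, so a
    functional vanishing on \<open>W\<close> is automatically concentrated in degree
    \<open>d\<close>.\<close>
  define W where "W = {w. \<exists>f\<in>I. \<exists>g\<in>forms (int d - 1). hom_component (int d) w = f + l * g}"
  have zero_forms: "0 \<in> forms i" for i by (simp add: mem_forms_iff)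
  have "dp.subspace W"
  proof (rule dp.subspaceI)
    show "0 \<in> W"
      unfolding W_def using mpoly_ideal_zero[OF ideal_I] zero_forms
      by (auto simp: hom_component_forms intro!: bexI[of _ 0])
  next
    fix v w assume "v \<in> W" "w \<in> W"
    then obtain f g f' g' where *: "f \<in> I" "g \<in> forms (int d - 1)" "hom_component (int d) v = f + l * g"
      "f' \<in> I" "g' \<in> forms (int d - 1)" "hom_component (int d) w = f' + l * g'"
      by (auto simp: W_def)
    have "hom_component (int d) (v + w) = hom_component (int d) v + hom_component (int d) w"
      by (rule poly_mapping_eqI) (simp add: lookup_hom_component lookup_add when_def)
    then have "hom_component (int d) (v + w) = (f + f') + l * (g + g')"
      using * by (simp add: algebra_simps)
    moreover have "f + f' \<in> I" "g + g' \<in> forms (int d - 1)"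
      using * mpoly_ideal_add[OF ideal_I] dp.subspace_add[OF subspace_forms] by auto
    ultimately show "v + w \<in> W" unfolding W_def by blast
  next
    fix c w assume "w \<in> W"
    then obtain f g where *: "f \<in> I" "g \<in> forms (int d - 1)" "hom_component (int d) w = f + l * g"
      by (auto simp: W_def)
    have "hom_component (int d) (dp_scale c w) = dp_scale c (hom_component (int d) w)"
      by (rule poly_mapping_eqI) (simp add: lookup_hom_component lookup_dp_scale when_def)
    also have "\<dots> = const c * f + l * dp_scale c g"
      unfolding * by (simp add: algebra_simps flip: const_mult)
    finally show "dp_scale c w \<in> W"
      unfolding W_def using mpoly_ideal_mult[OF ideal_I *(1)] dp.subspace_scale[OF subspace_forms *(2)]
      by blast
  qed
  moreover have "h \<notin> W"
    using contra h by (simp add: W_def hom_component_forms)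
  ultimately obtain \<phi> where "Vector_Spaces.linear dp_scale (*) \<phi>"
    and \<phi>_W: "\<And>w. w \<in> W \<Longrightarrow> \<phi> w = 0" and "\<phi> h = 1"
    using separating_functional by blast
  interpret \<phi>: Vector_Spaces.linear dp_scale "(*)" \<phi> by fact
  have forms_W: "f \<in> W" if "f \<in> forms i" "i \<noteq> int d" for f i
  proof -
    have "hom_component (int d) f = 0"
      using that by (intro poly_mapping_eqI) (auto simp: lookup_hom_component mem_forms_iff when_def)
    then show ?thesis
      unfolding W_def using mpoly_ideal_zero[OF ideal_I] zero_forms[of "int d - 1"]
      by (auto intro!: bexI[of _ 0])
  qed
  have I_W: "I \<subseteq> W"
  proof
    fix f assume "f \<in> I"
    then have "hom_component (int d) f \<in> I" by (rule homogeneous_idealD(2)[OF hom])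
    moreover have "hom_component (int d) f = hom_component (int d) f + l * 0" by simp
    ultimately show "f \<in> W" unfolding W_def using zero_forms by blast
  qed
  have l_W: "l * g \<in> W" if "g \<in> forms i" for g i
  proof (cases "i = int d - 1")
    case True
    then have "l * g \<in> forms (int d)" using forms_mult[OF l that] by simp
    then show ?thesis
      unfolding W_def using that True mpoly_ideal_zero[OF ideal_I]
      by (metis (mono_tags, lifting) add_0 hom_component_forms mem_Collect_eq)
  next
    case False
    then show ?thesis using forms_W[OF forms_mult[OF l that]] by simp
  qed
  \<comment> \<open>The functional \<open>\<phi>\<close> is turned into an element of the divided
    power algebra whose coefficients are its values on monomials.\<close>
  define F where "F = (\<Sum>m | int (mdeg m) = int d. single m (\<phi> (single m 1)))"
  have lookup_F: "lookup F m = \<phi> (single m 1)" for m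
  proof -
    have finite: "finite {m :: 'n \<Rightarrow>\<^sub>0 nat. mdeg m = d}"
      using finite_mdeg[of "int d", where ?'n = 'n] by simp
    have "lookup F m = (if mdeg m = d then \<phi> (single m 1) else 0)"
      using finite
      by (simp add: F_def lookup_sum lookup_single when_def sum.delta)
    also have "\<dots> = \<phi> (single m 1)"
      using \<phi>_W[OF forms_W[of "single m 1" "int (mdeg m)"]] by auto
    finally show ?thesis .
  qed
  \<comment> \<open>By adjointness, \<open>f\<close> annihilates \<open>F\<close> exactly when
    \<open>\<phi>\<close> vanishes on all monomial multiples of \<open>f\<close>. This is applied to
    the elements of \<open>I\<close> and to \<open>l\<close>.\<close>
  have contract_F: "lookup (contract f F) e = \<phi> (f * single e 1)" for f e
  proof -
    have "f * single e 1 = (\<Sum>m\<in>keys f. dp_scale (lookup f m) (single (m + e) 1))"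
      by (subst mpoly_eq_sum_single[of f])
        (simp add: sum_distrib_right mult_single const_def flip: const_mult)
    then show ?thesis
      by (simp add: lookup_contract lookup_F \<phi>.sum \<phi>.scale)
  qed
  have "F \<in> inverse_system I"
    unfolding inverse_system_def
  proof (intro CollectI ballI poly_mapping_eqI)
    fix f e assume "f \<in> I"
    then have "f * single e 1 \<in> W"
      using mpoly_ideal_mult[OF ideal_I, of f "single e 1"] I_W by (auto simp: mult.commute)
    then show "lookup (contract f F) e = lookup 0 e"
      using \<phi>_W by (simp add: contract_F)
  qed
  moreover have "F \<in> dp_component (- int d)"
    unfolding dp_component_def
  proof (intro CollectI ballI)
    fix m assume "m \<in> keys F"
    then have "\<phi> (single m 1) \<noteq> 0" by (simp add: in_keys_iff lookup_F)
    then have "int (mdeg m) = int d" using \<phi>_W forms_W[of "single m 1" "int (mdeg m)"] by auto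
    then show "- int (mdeg m) = - int d" by simp
  qed
  moreover have "contract l F = 0"
    by (rule poly_mapping_eqI)
      (use \<phi>_W l_W[of "single _ 1", OF single_in_forms[OF refl]] in \<open>simp add: contract_F\<close>)
  ultimately have "F = 0" using inj by blast
  \<comment> \<open>The value of \<open>\<phi>\<close> at \<open>h\<close> is the coefficient at the
    exponent 0 of the contraction of \<open>F\<close> by \<open>h\<close>.\<close>
  then have "\<phi> h = 0"
    using contract_F[of h 0] by (simp add: contract_def)
  with \<open>\<phi> h = 1\<close> show False by simp
qed

text \<open>The three ranges of \<open>i\<close> rest on one hypothesis each: the initial degree
  gives injectivity below \<open>d\<close>, the narrow direction surjectivity at \<open>d\<close>,
  and the socle degree surjectivity above \<open>d\<close>.\<close>

lemma mult_maximal_rank_narrow: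
  fixes I :: "('n::finite, 'k::field) mpoly set"
  assumes hom: "homogeneous_ideal I" and art: "artinian_ring (quotient_algebra I)"
    and d: "d \<ge> 1" "socle_top_degree I = d" "initial_degree I = d"
    and x: "narrow_direction d I x"
    and l: "l \<in> forms 1" "\<And>c. c \<in> forms 0 \<Longrightarrow> l \<noteq> x * c"
  shows "mult_maximal_rank I l i"
proof -
  interpret mpoly_ideal I by (rule mpoly_ideal.intro[OF homogeneous_idealD(1)[OF hom]])
  note low = forms_eq_0_below_initial_degree[OF hom art]
  have zero_forms: "0 \<in> forms i" for i by (simp add: mem_forms_iff)
  \<comment> \<open>Since \<open>d\<close> is at least 1, degree 0 lies below the initial degree and
    \<open>I\<close> contains no nonzero constant.\<close>
  have "1 \<notin> I"
  proof
    assume "1 \<in> I"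
    moreover have "1 \<in> forms (int 0)" by (simp add: mem_forms_iff lookup_one when_def)
    ultimately have "(1 :: ('n, 'k) mpoly) = 0" using low d by (metis less_eq_Suc_le One_nat_def)
    then show False by simp
  qed
  moreover have "inj_on (quotient_action I l) (quotient_component I (i - 1)) \<or>
      quotient_component I i \<subseteq> quotient_action I l ` quotient_component I (i - 1)"
  proof (cases i "int d" rule: linorder_cases)
    case less
    \<comment> \<open>The constant \<open>c = 0\<close> is allowed, so not being a multiple of
      \<open>x\<close> excludes \<open>l = 0\<close>.\<close>
    have "l \<noteq> 0" using l(2)[OF zero_forms] by simp
    have "f = g" if "f \<in> forms (i - 1)" "g \<in> forms (i - 1)" "l * f - l * g \<in> I" for f g
    proof -
      have *: "l * (f - g) \<in> forms i"
        using forms_mult[OF l(1) forms_diff[OF that(1,2)]] by simp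
      have "l * (f - g) = 0"
      \<comment> \<open>Gradings are indexed by integers while \<open>low\<close> concerns natural
        degrees; in negative degrees the product vanishes because \<open>forms i\<close>
        does.\<close>
      proof (cases "i < 0")
        case True
        then show ?thesis using * by (simp add: forms_neg)
      next
        case False
        then have i: "i = int (nat i)" "nat i < initial_degree I" using less d(3) by auto
        have "l * (f - g) \<in> I" using that(3) by (simp only: right_diff_distrib)
        then show ?thesis using * i(1) by (intro low[OF _ _ i(2)]) simp_all
      qed
      then show ?thesis using linear_form_mult_eq_0[OF l(1) \<open>l \<noteq> 0\<close>] by fastforce
    qed
    note inj = this
    have "inj_on (quotient_action I l) (quotient_component I (i - 1))"
    proof (rule inj_onI)
      fix u v
      assume uv: "u \<in> quotient_component I (i - 1)" "v \<in> quotient_component I (i - 1)"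
        and eq: "quotient_action I l u = quotient_action I l v"
      obtain f g where fg: "f \<in> forms (i - 1)" "u = residue_class I f"
        "g \<in> forms (i - 1)" "v = residue_class I g"
        using uv unfolding quotient_component_def by blast
      have "l * f - l * g \<in> I"
        using eq by (simp only: fg quotient_action_residue residue_eq_iff)
      then show "u = v" using inj[OF fg(1,3)] fg(2,4) by simp
    qed
    then show ?thesis ..
  next
    case equal
    have "quotient_component I i \<subseteq> quotient_action I l ` quotient_component I (i - 1)"
    proof
      fix u assume "u \<in> quotient_component I i"
      then obtain h where h: "h \<in> forms (int d)" "u = residue_class I h"
        by (auto simp: quotient_component_def equal)
      then obtain f g where fg: "f \<in> I" "g \<in> forms (i - 1)" "h = f + l * g"
        using forms_subset_if_contract_injective[OF hom l(1)
          inverse_system_contract_injective[OF x l]] equal by metis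
      then have "u = quotient_action I l (residue_class I g)"
        by (simp add: h(2) quotient_action_residue residue_eq_iff)
      then show "u \<in> quotient_action I l ` quotient_component I (i - 1)"
        using fg(2) by (auto simp: quotient_component_def)
    qed
    then show ?thesis ..
  next
    case greater
    then have "i = int (nat i)" "d < nat i" by auto
    then have "forms i \<subseteq> I"
      using forms_subset_above_socle_top_degree[OF hom art, of "nat i"] d(2) by simp
    then have "residue_class I h = quotient_action I l (residue_class I 0)" if "h \<in> forms i" for h
      using that by (auto simp: quotient_action_residue residue_eq_iff)
    moreover have "residue_class I 0 \<in> quotient_component I (i - 1)"
      using zero_forms unfolding quotient_component_def by (rule imageI)
    ultimately have "quotient_component I i \<subseteq> quotient_action I l ` quotient_component I (i - 1)"
      unfolding quotient_component_def[of I i] by blast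
    then show ?thesis ..
  qed
  ultimately show ?thesis by (rule mult_maximal_rankI[OF _ l(1)])
qed

section \<open>The open set of linear forms\<close>

lemma eval_mpoly_superset:
  assumes "finite A" "keys p \<subseteq> A"
  shows "eval_mpoly p a = (\<Sum>m\<in>A. lookup p m * (\<Prod>i\<in>UNIV. a i ^ lookup m i))"
  unfolding eval_mpoly_def using assms
  by (intro sum.mono_neutral_left) (auto simp: in_keys_iff)

lemma eval_mpoly_diff: "eval_mpoly (p - q) a = eval_mpoly p a - eval_mpoly q a"
proof -
  have "keys (p - q) \<subseteq> keys p \<union> keys q"
    by (auto simp: in_keys_iff lookup_minus)
  then show ?thesis
    by (simp add: eval_mpoly_superset[of "keys p \<union> keys q"] lookup_minus
      left_diff_distrib sum_subtractf)
qed

lemma eval_mpoly_single: "eval_mpoly (single m c) a = c * (\<Prod>i\<in>UNIV. a i ^ lookup m i)"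
  by (subst eval_mpoly_superset[of "{m}"]) (auto simp: in_keys_iff lookup_single when_def)

lemma eval_mpoly_variable: "eval_mpoly (single (single j 1) c) a = c * a j"
proof -
  have "(\<Prod>i\<in>UNIV. a i ^ lookup (single j 1) i) = (\<Prod>i\<in>UNIV. if i = j then a i else 1)"
    by (intro prod.cong) (auto simp: lookup_single when_def)
  then show ?thesis by (simp add: eval_mpoly_single)
qed

text \<open>A two-by-two minor of the matrix with rows the coefficients of \<open>x\<close> and the
  coordinates of a generic linear form. The variables here stand for those coordinates.\<close>

definition minor :: "('n, 'k::field) mpoly \<Rightarrow> 'n \<Rightarrow> 'n \<Rightarrow> ('n, 'k) mpoly" where
  "minor x i j = single (single i 1) (linear_coeffs x j) - single (single j 1) (linear_coeffs x i)"

lemma eval_minor: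
  "eval_mpoly (minor x i j) a = linear_coeffs x j * a i - linear_coeffs x i * a j"
  unfolding minor_def by (simp only: eval_mpoly_diff eval_mpoly_variable)

lemma minor_in_forms: "minor x i j \<in> forms 1"
  unfolding minor_def by (intro forms_diff) auto

lemma linear_coeffs_mult_const: "c \<in> forms 0 \<Longrightarrow> \<exists>b. \<forall>i. linear_coeffs (x * c) i = b * linear_coeffs x i"
  unfolding forms_0_eq
  by (auto simp: linear_coeffs_def const_mult lookup_dp_scale mult.commute[of x])

lemma zariski_open_nonmultiples:
  fixes x :: "('n::finite, 'k::field) mpoly"
  assumes card: "CARD('n) \<ge> 2" and x: "x \<in> forms 1"
  shows "\<exists>U. zariski_open_lines U \<and> U \<noteq> {} \<and>
    (\<forall>l\<in>forms 1. l \<noteq> 0 \<and> line l \<in> U \<longrightarrow> (\<forall>c\<in>forms 0. l \<noteq> x * c))"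
proof -
  \<comment> \<open>For \<open>x = 0\<close> all minors vanish identically, so the constant 1 is
    added; the open set is then the whole projective space.\<close>
  define T where "T = range (\<lambda>(i, j). minor x i j) \<union> (if x = 0 then {1} else {})"
  define U where "U = {line l | l. l \<in> forms 1 \<and> l \<noteq> 0 \<and> (\<exists>p\<in>T. eval_mpoly p (linear_coeffs l) \<noteq> 0)}"
  have "\<exists>j. p \<in> forms j" if "p \<in> T" for p
  proof -
    have "1 \<in> forms 0" by (simp add: mem_forms_iff lookup_one when_def)
    with that minor_in_forms show ?thesis by (auto simp: T_def split: if_splits)
  qed
  then have "zariski_open_lines U"
    unfolding zariski_open_lines_def U_def by blast
  moreover have "U \<noteq> {}"
  proof -
    let ?X = "\<lambda>j. single (single j 1) 1 :: ('n, 'k) mpoly"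
    have X: "?X j \<in> forms 1" "?X j \<noteq> 0" for j
      by simp (metis lookup_single_eq lookup_zero zero_neq_one)
    have "\<exists>j. \<exists>p\<in>T. eval_mpoly p (linear_coeffs (?X j)) \<noteq> 0"
    proof (cases "x = 0")
      case True
      then have "1 \<in> T" by (simp add: T_def)
      moreover have "eval_mpoly 1 a = (1 :: 'k)" for a :: "'n \<Rightarrow> 'k"
        using eval_mpoly_single[of 0 1 a] by simp
      ultimately show ?thesis by (metis zero_neq_one)
    next
      case False
      then obtain m where m: "lookup x m \<noteq> 0"
        by (metis poly_mapping_eqI lookup_zero)
      then have "mdeg m = 1" using x by (auto simp: mem_forms_iff)
      then obtain i where "m = single i 1" by (rule mdeg_1E)
      with m have i: "linear_coeffs x i \<noteq> 0" by (simp add: linear_coeffs_def)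
      \<comment> \<open>This is where two variables are required: a variable \<open>j\<close> other
        than \<open>i\<close> gives a linear form whose minor with \<open>x\<close> is the nonzero
        coefficient of \<open>x\<close> at \<open>i\<close>, up to sign.\<close>
      have "UNIV \<noteq> {i}"
      proof
        assume "UNIV = {i}"
        from arg_cong[OF this, of card] card show False by simp
      qed
      then obtain j where "j \<noteq> i" by blast
      then have "lookup (single j (1 :: nat)) i \<noteq> lookup (single i 1) i"
        by (simp add: lookup_single)
      then have "single j (1 :: nat) \<noteq> single i 1" by metis
      then have "linear_coeffs (?X j) i = 0" "linear_coeffs (?X j) j = 1"
        by (simp_all add: linear_coeffs_def lookup_single_not_eq)
      then have "eval_mpoly (minor x i j) (linear_coeffs (?X j)) \<noteq> 0"
        using i by (simp add: eval_minor)
      moreover have "minor x i j \<in> T" by (auto simp: T_def)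
      ultimately show ?thesis by blast
    qed
    then show ?thesis using X unfolding U_def by blast
  qed
  moreover have "l \<noteq> x * c" if "line l \<in> U" "c \<in> forms 0" for l c
  proof
    assume lx: "l = x * c"
    \<comment> \<open>Membership of the line only supplies some representative \<open>l'\<close>
      with a nonvanishing equation. Being a scalar multiple of \<open>l\<close>, it is again a
      constant multiple of \<open>x\<close>, which makes every minor vanish.\<close>
    from that(1)[unfolded U_def, THEN CollectD]
    obtain l' p where l': "line l = line l'" "l' \<noteq> 0" "p \<in> T" "eval_mpoly p (linear_coeffs l') \<noteq> 0"
      by (elim exE conjE bexE)
    have "l' \<in> line l'" unfolding line_def by (rule range_eqI[of _ _ 1]) simp
    then have "l' \<in> line l" by (simp only: l'(1))
    then obtain b where "l' = const b * l" unfolding line_def by (rule rangeE)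
    then have l'_eq: "l' = x * (const b * c)" by (simp add: lx ac_simps)
    then have "x \<noteq> 0" using l'(2) by auto
    then obtain i j where p: "p = minor x i j" using l'(3) by (auto simp: T_def)
    have "const b * c \<in> forms 0"
      using forms_mult[OF _ that(2), of _ 0] by (auto simp: forms_0_eq)
    then obtain a where "\<And>i. linear_coeffs l' i = a * linear_coeffs x i"
      using linear_coeffs_mult_const unfolding l'_eq by blast
    then show False using l'(4) by (simp add: p eval_minor)
  qed
  ultimately show ?thesis by blast
qed

theorem proposition2p3:
  fixes I :: "('n::finite, 'k::field) mpoly set" and d :: nat
  assumes "CARD('n) \<ge> 2"
    and "homogeneous_ideal I"
    and "artinian_ring (quotient_algebra I)"
    and "extremely_narrow d I"
  shows "weak_lefschetz I \<and>
    (\<forall>x. narrow_direction d I x \<longrightarrow>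
      (\<forall>l \<in> forms 1. \<not> x dvd l \<longrightarrow> (\<forall>i. mult_maximal_rank I l i)))"
proof -
  have d: "d \<ge> 1" "socle_top_degree I = d" "initial_degree I = d"
    and ex: "\<exists>x. narrow_direction d I x"
    using assms(4) by (auto simp: extremely_narrow_def)
  note max_rank = mult_maximal_rank_narrow[OF assms(2,3) d]
  obtain x where x: "narrow_direction d I x" using ex by blast
  then have "x \<in> forms 1" by (simp add: narrow_direction_def)
  with assms(1) obtain U where "zariski_open_lines U" "U \<noteq> {}"
    "\<forall>l\<in>forms 1. l \<noteq> 0 \<and> line l \<in> U \<longrightarrow> (\<forall>c\<in>forms 0. l \<noteq> x * c)"
    using zariski_open_nonmultiples by blast
  then have "weak_lefschetz I"
    unfolding weak_lefschetz_def using max_rank[OF x] by blast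
  \<comment> \<open>If \<open>x\<close> does not divide \<open>l\<close>, then in particular
    \<open>l\<close> differs from \<open>x * c\<close> for every constant \<open>c\<close>.\<close>
  then show ?thesis using max_rank dvdI by metis
qed

end
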